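(* Let $\mathbb{F}$ be a field, let $n\ge 2$ and $k\ge 1$ be integers, and let $A\in \mathbb{M}_{n}(\mathbb{F})$ be a nonzero matrix. Then there exist an invertible matrix $U\in \mathbb{M}_{n}(\mathbb{F})$ and a nilpotent matrix $N\in \mathbb{M}_{n}(\mathbb{F})$ with $N^k=0$ such that $A=U+N$ if, and only if, the rank of $A$ is greater than or equal to $\frac{n}{k}$.
   Context: $\mathbb{M}_n(\mathbb{F})$ denotes the ring of $n\times n$ matrices over $\mathbb{F}$. The inequality $\operatorname{rank}(A)\ge \frac{n}{k}$ is an inequality of rational numbers ($\frac nk$ need not be an integer). *)

theory Defs
  imports "Jordan_Normal_Form.DL_Rank" "HOL.Rat"
begin

definition nilpotent_mat :: "'a :: semiring_1 mat \<Rightarrow> bool" where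
  "nilpotent_mat A \<longleftrightarrow>
     square_mat A \<and> (\<exists>m\<ge>1. A ^\<^sub>m m = 0\<^sub>m (dim_row A) (dim_row A))"

end

theory Submission
  imports Defs
begin

text \<open>
  Let \<open>r\<close> be the rank of \<open>A\<close>.

  If \<open>A = U + N\<close> and \<open>k r < n\<close>, the conditions \<open>A N\<^sup>i x = 0\<close> for \<open>i < k\<close> amount to \<open>k r\<close> linear
  equations, so they have a solution \<open>x \<noteq> 0\<close>. Then \<open>U N\<^sup>i x = - N\<^bsup>i+1\<^esup> x\<close>, and descending from
  \<open>N\<^sup>k x = 0\<close> yields \<open>x = 0\<close>, a contradiction.

  Conversely, \<open>A\<close> is similar to a block matrix with rows \<open>(X, G)\<close> and \<open>(0, 0)\<close> where \<open>G\<close> is \<open>r \<times> r\<close>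
  and invertible: with the range of \<open>A\<close> spanned by the first \<open>r\<close> basis vectors, the last \<open>r\<close> columns
  are made independent one after the other by adding an earlier basis vector to a later one.
  Subtracting the shift \<open>e\<^sub>j \<mapsto> e\<^bsub>j+r\<^esub>\<close>, whose \<open>k\<close>-th power vanishes if \<open>k r \<ge> n\<close>, leaves rows \<open>(X, G)\<close> and
  \<open>(-1, 0)\<close>, an invertible matrix.
\<close>

section \<open>Homogeneous systems, bases and row reduction over a field\<close>

text \<open>Padding the vectors \<open>g i\<close> with zero rows to a square matrix of size
  \<open>n\<close> leaves at least one zero row because \<open>card I < n\<close>. The determinant
  therefore vanishes and the kernel is nontrivial.\<close>

lemma homogeneous_system_nontrivial:
  fixes g :: "'i \<Rightarrow> 'a :: field vec"
  assumes "finite I" and "card I < n" and g: "\<And>i. i \<in> I \<Longrightarrow> g i \<in> carrier_vec n"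
  obtains v where "v \<in> carrier_vec n" "v \<noteq> 0\<^sub>v n" "\<And>i. i \<in> I \<Longrightarrow> g i \<bullet> v = 0"
proof -
  obtain h where h: "bij_betw h {0..<card I} I"
    using ex_bij_betw_nat_finite[OF \<open>finite I\<close>] by blast
  define c where "c = (\<lambda>i. if i < card I then g (h i) else 0\<^sub>v n)"
  \<comment> \<open>Row \<open>n - 1\<close> lies beyond the \<open>card I\<close> vectors; its zero
    is written out in the form that \<open>det_row_0\<close> expects.\<close>
  define M where "M = mat\<^sub>r n n (\<lambda>i. if i = n - 1 then 0\<^sub>v n else c i)"
  have c: "c i \<in> carrier_vec n" for i
    using g bij_betwE[OF h] by (auto simp: c_def)
  have M: "M \<in> carrier_mat n n" by (simp add: M_def)
  have "det M = 0"
    unfolding M_def using assms(2) c by (intro det_row_0) auto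
  then obtain v where v: "v \<in> carrier_vec n" "v \<noteq> 0\<^sub>v n" "M *\<^sub>v v = 0\<^sub>v n"
    using det_0_iff_vec_prod_zero_field[OF M] by blast
  have "g i \<bullet> v = 0" if "i \<in> I" for i
  proof -
    have "i \<in> h ` {0..<card I}" using that bij_betw_imp_surj_on[OF h] by simp
    then obtain m where m: "m < card I" "i = h m" by auto
    have "c m \<bullet> v = 0"
    proof (cases "m = n - 1")
      case True
      then show ?thesis using m assms(2) v g by (auto simp: c_def)
    next
      case False
      have "(M *\<^sub>v v) $ m = row M m \<bullet> v" using m assms(2) M by simp
      also have "row M m = c m"
        unfolding M_def using False m assms(2) c by (subst row_mat_of_row_fun) auto
      finally show ?thesis using v(3) m assms(2) by simp
    qed
    then show ?thesis using m by (simp add: c_def)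
  qed
  with v that show ?thesis by blast
qed

lemma det_nonzero_inverse:
  fixes P :: "'a :: field mat"
  assumes "P \<in> carrier_mat n n" and "det P \<noteq> 0"
  obtains Q where "Q \<in> carrier_mat n n" "P * Q = 1\<^sub>m n" "Q * P = 1\<^sub>m n"
  using det_non_zero_imp_unit[OF assms, of "()"] that
  unfolding Units_def ring_mat_def by auto

text \<open>Independent sets have at most \<open>n\<close> elements, so some independent set
  containing \<open>S\<close> is maximal among those containing \<open>S\<close>. Every larger set
  still contains \<open>S\<close>, so it is maximal among all independent sets and hence a
  basis.\<close>

lemma (in vec_space) lin_indpt_extend_basis:
  assumes "S \<subseteq> carrier_vec n" and "lin_indpt S"
  obtains T where "S \<subseteq> T" "T \<subseteq> carrier_vec n" "lin_indpt T" "finite T" "card T = n"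
proof -
  have li: "finite T \<and> card T \<le> n" if "T \<subseteq> carrier_vec n" "lin_indpt T" for T
    using that li_le_dim[of T] fin_dim by (simp add: dim_is_n)
  define P where "P = (\<lambda>T. S \<subseteq> T \<and> T \<subseteq> carrier_vec n \<and> lin_indpt T)"
  obtain T where T: "finite T" "maximal T P"
    using maximal_exists[of P n S] li assms unfolding P_def by blast
  then have PT: "S \<subseteq> T" "T \<subseteq> carrier_vec n" "lin_indpt T" unfolding maximal_def P_def by auto
  have "maximal T (\<lambda>T. T \<subseteq> carrier_vec n \<and> lin_indpt T)"
    using T(2) PT unfolding maximal_def P_def by auto
  then have "basis T" by (rule max_li_is_basis)
  then have "card T = n" using dim_basis[OF T(1)] dim_is_n by simp
  with PT T that show ?thesis by blast
qed

lemma (in vec_space) rank_row_reduction: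
  assumes A: "A \<in> carrier_mat n nc"
  obtains P Q E where
    "P \<in> carrier_mat n n" "Q \<in> carrier_mat n n" "P * Q = 1\<^sub>m n" "Q * P = 1\<^sub>m n"
    "\<And>i j. rank A \<le> i \<Longrightarrow> i < n \<Longrightarrow> j < nc \<Longrightarrow> (Q * A) $$ (i, j) = 0"
    "E \<in> carrier_mat nc (rank A)"
    \<comment> \<open>\<open>E\<close> expresses a basis of the column space by the columns of \<open>A\<close>\<close>
    "\<And>v. v \<in> carrier_vec (rank A) \<Longrightarrow> A *\<^sub>v (E *\<^sub>v v) = 0\<^sub>v n \<Longrightarrow> v = 0\<^sub>v (rank A)"
proof -
  let ?C = "set (cols A)"
  have C: "?C \<subseteq> carrier_vec n" using A cols_dim by blast
  obtain S where S: "maximal S (\<lambda>T. T \<subseteq> ?C \<and> lin_indpt T)"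
    using maximal_exists[of "\<lambda>T. T \<subseteq> ?C \<and> lin_indpt T" "card ?C" "{}"]
    by (meson List.finite_set card_mono empty_iff empty_subsetI finite_lin_indpt2 rev_finite_subset)
  define r where "r = rank A"
  have card_S: "card S = r" using rank_card_indpt[OF A S] by (simp add: r_def)
  have SC: "S \<subseteq> ?C" and li: "lin_indpt S" using S by (auto simp: maximal_def)
  have Sn: "S \<subseteq> carrier_vec n" using SC C by blast
  have span: "?C \<subseteq> span S"
  proof
    fix s assume s: "s \<in> ?C"
    show "s \<in> span S"
    proof (rule ccontr)
      assume ns: "s \<notin> span S"
      then have "lin_indpt (S \<union> {s})"
        using Sn s C li by (meson lin_dep_iff_in_span rev_subsetD span_mem)
      then have "S \<union> {s} = S" using S s SC by (auto simp: maximal_def)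
      then show False using ns span_mem[of S s] Sn s C by auto
    qed
  qed
  obtain T where T: "S \<subseteq> T" "T \<subseteq> carrier_vec n" "lin_indpt T" "finite T" "card T = n"
    using lin_indpt_extend_basis[OF Sn li] .
  have fS: "finite S" using T finite_subset by blast
  obtain xs where xs: "set xs = S" "distinct xs" using finite_distinct_list[OF fS] by blast
  obtain ys where ys: "set ys = T - S" "distinct ys"
    using finite_distinct_list[of "T - S"] T by blast
  have len_xs: "length xs = r" using xs card_S distinct_card by fastforce
  have dist: "distinct (xs @ ys)" using xs ys by auto
  have set: "set (xs @ ys) = T" using xs ys T by auto
  have len: "length (xs @ ys) = n" using distinct_card[OF dist] set T by simp
  have rn: "r \<le> n" using len len_xs by simp
  \<comment> \<open>The columns of \<open>P\<close> form a basis whose first \<open>r\<close>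
    members span the column space of \<open>A\<close>. The inverse \<open>Q\<close> sends that space
    into the span of the first \<open>r\<close> unit vectors, which is why the rows of
    \<open>Q * A\<close> from \<open>r\<close> on vanish.\<close>
  define P where "P = mat_of_cols n (xs @ ys)"
  have P: "P \<in> carrier_mat n n" using len by (intro carrier_matI) (simp_all add: P_def)
  have colsP: "cols P = xs @ ys" unfolding P_def using set T by (intro cols_mat_of_cols) auto
  have "rank P = n" using lin_indpt_full_rank[OF P] colsP dist set T by simp
  then have "det P \<noteq> 0" using det_rank_iff[OF P] by simp
  then obtain Q where Q: "Q \<in> carrier_mat n n" "P * Q = 1\<^sub>m n" "Q * P = 1\<^sub>m n"
    using det_nonzero_inverse[OF P] by blast
  define B where "B = mat_of_cols n xs"
  have B: "B \<in> carrier_mat n r" using len_xs by (intro carrier_matI) (simp_all add: B_def)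
  have colsB: "cols B = xs" unfolding B_def using xs Sn by (intro cols_mat_of_cols) auto
  have zero: "(Q * A) $$ (i, j) = 0" if ij: "r \<le> i" "i < n" "j < nc" for i j
  proof -
    have "col A j \<in> span S" using span ij A by (auto simp: cols_def)
    then have "col A j \<in> col_space B" by (simp add: col_space_def colsB xs)
    then obtain y where y: "y \<in> carrier_vec r" "B *\<^sub>v y = col A j"
      using col_space_eq[OF B] B by auto
    \<comment> \<open>The coordinates of \<open>col A j\<close> in the basis given by
      \<open>P\<close>: those belonging to \<open>ys\<close> are zero.\<close>
    define z where "z = y @\<^sub>v 0\<^sub>v (n - r)"
    have z: "z \<in> carrier_vec n" using y rn by (intro carrier_vecI) (auto simp: z_def)
    have "P *\<^sub>v z = B *\<^sub>v y"
    proof (rule eq_vecI)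
      fix a assume "a < dim_vec (B *\<^sub>v y)"
      then have a: "a < n" using B by simp
      have "(P *\<^sub>v z) $ a = (\<Sum>c\<in>{0..<n}. (xs @ ys) ! c $ a * z $ c)"
        using a P z len by (auto simp: scalar_prod_def P_def mat_of_cols_def intro!: sum.cong)
      also have "\<dots> = (\<Sum>c\<in>{0..<r}. (xs @ ys) ! c $ a * z $ c)"
        using rn y by (intro sum.mono_neutral_right) (auto simp: z_def)
      also have "\<dots> = (\<Sum>c\<in>{0..<r}. xs ! c $ a * y $ c)"
        using rn y len_xs by (intro sum.cong) (auto simp: z_def nth_append)
      also have "\<dots> = (B *\<^sub>v y) $ a"
        using a y(1) len_xs by (simp add: scalar_prod_def B_def mat_of_cols_def)
      finally show "(P *\<^sub>v z) $ a = (B *\<^sub>v y) $ a" .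
    qed (use P B in auto)
    then have "Q *\<^sub>v col A j = Q *\<^sub>v (P *\<^sub>v z)" using y by simp
    also have "\<dots> = (Q * P) *\<^sub>v z" using assoc_mult_mat_vec[OF Q(1) P z] by simp
    also have "\<dots> = z" using Q z by simp
    finally have "Q *\<^sub>v col A j = z" .
    moreover have "(Q * A) $$ (i, j) = (Q *\<^sub>v col A j) $ i" using Q A ij by simp
    ultimately show ?thesis using ij y by (simp add: z_def)
  qed
  have "\<exists>e. e \<in> carrier_vec nc \<and> A *\<^sub>v e = xs ! j" if "j < r" for j
  proof -
    have "xs ! j \<in> ?C" using that len_xs xs SC nth_mem by blast
    then have "xs ! j \<in> col_space A"
      using C span_mem unfolding col_space_def by auto
    then show ?thesis using col_space_eq[OF A] A by auto
  qed
  then obtain e where e: "\<And>j. j < r \<Longrightarrow> e j \<in> carrier_vec nc" "\<And>j. j < r \<Longrightarrow> A *\<^sub>v e j = xs ! j"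
    by metis
  define E where "E = mat_of_cols nc (map e [0..<r])"
  have E: "E \<in> carrier_mat nc r" by (intro carrier_matI) (simp_all add: E_def)
  have AE: "A * E = B"
  proof (rule mat_col_eqI)
    fix j assume "j < dim_col B"
    then have j: "j < r" using B by simp
    have "col (A * E) j = A *\<^sub>v col E j" by (rule col_mult2[OF A E j])
    also have "col E j = e j" using e j by (simp add: E_def)
    also have "A *\<^sub>v e j = col B j"
      using e j B colsB by (metis carrier_matD(2) cols_nth)
    finally show "col (A * E) j = col B j" .
  qed (use A B E in auto)
  have inj: "v = 0\<^sub>v r" if v: "v \<in> carrier_vec r" "A *\<^sub>v (E *\<^sub>v v) = 0\<^sub>v n" for v
  proof (rule ccontr)
    assume "v \<noteq> 0\<^sub>v r"
    moreover have "B *\<^sub>v v = 0\<^sub>v n" using v A E by (simp flip: AE)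
    ultimately show False using lin_depI[OF B v(1)] colsB xs li by simp
  qed
  show ?thesis using that[OF P Q(1-3) _ E[unfolded r_def]] zero inj unfolding r_def by blast
qed

section \<open>Making the last \<open>r\<close> columns independent by similarity\<close>

lemma mult_mat_vec_eq_zero_cancel:
  fixes T :: "'a :: comm_ring_1 mat"
  assumes "T' \<in> carrier_mat n n" "T \<in> carrier_mat n n" "T' * T = 1\<^sub>m n" "w \<in> carrier_vec n"
    and "T *\<^sub>v w = 0\<^sub>v n"
  shows "w = 0\<^sub>v n"
proof -
  have "w = (T' * T) *\<^sub>v w" using assms by simp
  also have "\<dots> = T' *\<^sub>v (T *\<^sub>v w)" using assms(1,2,4) by simp
  also have "\<dots> = 0\<^sub>v n" using assms(1,5) by auto
  finally show ?thesis .
qed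

text \<open>Independence of the columns with index in \<open>J\<close>, stated through kernel
  vectors supported on \<open>J\<close>. Equal columns at different indices thus count as dependent,
  whereas a set of vectors would identify them.\<close>

definition cols_indpt :: "'a :: comm_ring_1 mat \<Rightarrow> nat set \<Rightarrow> bool" where
  "cols_indpt A J \<longleftrightarrow>
     (\<forall>x \<in> carrier_vec (dim_col A). (\<forall>i < dim_col A. i \<notin> J \<longrightarrow> x $ i = 0) \<longrightarrow>
        A *\<^sub>v x = 0\<^sub>v (dim_row A) \<longrightarrow> x = 0\<^sub>v (dim_col A))"

lemma cols_indptI:
  assumes "A \<in> carrier_mat nr nc"
    and "\<And>x. x \<in> carrier_vec nc \<Longrightarrow> (\<And>i. i < nc \<Longrightarrow> i \<notin> J \<Longrightarrow> x $ i = 0) \<Longrightarrow>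
           A *\<^sub>v x = 0\<^sub>v nr \<Longrightarrow> x = 0\<^sub>v nc"
  shows "cols_indpt A J"
  using assms unfolding cols_indpt_def by auto

lemma cols_indptD:
  assumes "cols_indpt A J" "A \<in> carrier_mat nr nc" "x \<in> carrier_vec nc"
    and "\<And>i. i < nc \<Longrightarrow> i \<notin> J \<Longrightarrow> x $ i = 0" "A *\<^sub>v x = 0\<^sub>v nr"
  shows "x = 0\<^sub>v nc"
  using assms unfolding cols_indpt_def by auto

text \<open>Right multiplication by this matrix adds \<open>a\<close> times column \<open>j\<close>
  to column \<open>b\<close>. The formula turns a kernel vector of the modified matrix into a
  relation for the original one.\<close>

lemma addrow_mat_mult_vec:
  fixes x :: "'a :: comm_ring_1 vec"
  assumes "x \<in> carrier_vec n" "j < n" "b < n" "j \<noteq> b"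
  shows "addrow_mat n a j b *\<^sub>v x = x + (a * x $ b) \<cdot>\<^sub>v unit_vec n j"
proof (rule eq_vecI)
  fix i assume "i < dim_vec (x + (a * x $ b) \<cdot>\<^sub>v unit_vec n j)"
  then have i: "i < n" by simp
  have "(addrow_mat n a j b *\<^sub>v x) $ i = (\<Sum>c\<in>{0..<n}. addrow_mat n a j b $$ (i, c) * x $ c)"
    using i assms by (simp add: scalar_prod_def)
  also have "\<dots> = (\<Sum>c\<in>{0..<n}. (if i = c then x $ c else 0) + (if b = c then if i = j then a * x $ c else 0 else 0))"
    using i assms by (intro sum.cong) (auto simp: algebra_simps)
  also have "\<dots> = x $ i + (if i = j then a * x $ b else 0)"
    using i assms by (simp add: sum.distrib sum.delta)
  finally show "(addrow_mat n a j b *\<^sub>v x) $ i = (x + (a * x $ b) \<cdot>\<^sub>v unit_vec n j) $ i"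
    using i assms by auto
qed (use assms in auto)

text \<open>If \<open>x $ b\<close> were zero, \<open>x\<close> would be a nonzero kernel vector
  supported on \<open>{d..<b}\<close>, against independence; so the relation can be divided by
  \<open>x $ b\<close>. The case \<open>w = 0\<close> concerns \<open>A\<close> itself, and a unit
  vector \<open>w\<close> concerns \<open>A\<close> after column \<open>j\<close> has been added to
  column \<open>b\<close>.\<close>

lemma trailing_col_relation:
  fixes A :: "'a :: field mat"
  assumes A: "A \<in> carrier_mat n n" and indpt: "cols_indpt A {d..<b}" and "b < n"
    and x: "x \<in> carrier_vec n" "x \<noteq> 0\<^sub>v n" "\<And>i. i < n \<Longrightarrow> i \<notin> {d..<Suc b} \<Longrightarrow> x $ i = 0"
    and w: "w \<in> carrier_vec n" and eq: "A *\<^sub>v (x + x $ b \<cdot>\<^sub>v w) = 0\<^sub>v n"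
  obtains y where "y \<in> carrier_vec n" "\<And>i. i < n \<Longrightarrow> i \<notin> {d..<b} \<Longrightarrow> y $ i = 0"
    "A *\<^sub>v (unit_vec n b + w) = A *\<^sub>v y"
proof -
  \<comment> \<open>Chosen so that \<open>x\<close> divided by \<open>x $ b\<close> is
    \<open>unit_vec n b - y\<close>.\<close>
  define y where "y = vec n (\<lambda>i. if i = b then 0 else - (x $ i / x $ b))"
  have xb: "x $ b \<noteq> 0"
  proof
    assume 0: "x $ b = 0"
    then have "x + x $ b \<cdot>\<^sub>v w = x" using x w by auto
    moreover have "x $ i = 0" if "i < n" "i \<notin> {d..<b}" for i
      using that 0 x(3)[of i] by (cases "i = b") auto
    ultimately show False using cols_indptD[OF indpt A x(1)] eq x(2) by auto
  qed
  have y: "y \<in> carrier_vec n" by (simp add: y_def)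
  have "x + x $ b \<cdot>\<^sub>v w = x $ b \<cdot>\<^sub>v ((unit_vec n b + w) - y)"
    using x w xb \<open>b < n\<close> by (auto simp: y_def field_simps intro!: eq_vecI)
  then have "x $ b \<cdot>\<^sub>v (A *\<^sub>v ((unit_vec n b + w) - y)) = 0\<^sub>v n"
    using eq A w y by (simp add: mult_mat_vec[of A n n])
  then have "A *\<^sub>v ((unit_vec n b + w) - y) = 0\<^sub>v n"
    using xb A by (auto simp: vec_eq_iff)
  then have "A *\<^sub>v (unit_vec n b + w) - A *\<^sub>v y = 0\<^sub>v n"
    using A w y by (simp add: mult_minus_distrib_mat_vec[of A n n])
  then have "A *\<^sub>v (unit_vec n b + w) = A *\<^sub>v y"
    using A w y by (auto simp: vec_eq_iff)
  moreover have "y $ i = 0" if "i < n" "i \<notin> {d..<b}" for i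
    using that x(3)[of i] by (auto simp: y_def)
  ultimately show ?thesis using that y by blast
qed

text \<open>
  If every choice fails, each \<open>A e\<^sub>j\<close> with \<open>j \<le> b\<close> is a combination of the columns \<open>n - r, \<dots>, b - 1\<close>,
  so that \<open>r - 1\<close> columns span the range of \<open>A\<close>, contradicting that \<open>A E\<close> is injective.
\<close>
lemma cols_indpt_step:
  fixes A :: "'a :: field mat"
  assumes A: "A \<in> carrier_mat n n" and E: "E \<in> carrier_mat n r"
    and inj: "\<And>v. v \<in> carrier_vec r \<Longrightarrow> A *\<^sub>v (E *\<^sub>v v) = 0\<^sub>v n \<Longrightarrow> v = 0\<^sub>v r"
    and b: "r \<le> n" "n - r \<le> b" "b < n" and indpt: "cols_indpt A {n - r..<b}"
  shows "cols_indpt A {n - r..<Suc b} \<or>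
         (\<exists>j<b. cols_indpt (A * addrow_mat n 1 j b) {n - r..<Suc b})"
proof (rule ccontr)
  \<comment> \<open>These \<open>r - 1\<close> indices omit only \<open>b\<close>: columns after
    \<open>b\<close> represent themselves, and all others will be expressed by the columns in
    \<open>{n - r..<b}\<close>.\<close>
  let ?I = "{n - r..<n} - {b}"
  let ?supp = "\<lambda>y. \<forall>i<n. i \<notin> {n - r..<b} \<longrightarrow> y $ i = 0"
  assume *: "\<not> ?thesis"
  obtain yb where yb: "yb \<in> carrier_vec n" "?supp yb" "A *\<^sub>v unit_vec n b = A *\<^sub>v yb"
  proof -
    obtain x where x: "x \<in> carrier_vec n" "x \<noteq> 0\<^sub>v n"
      "\<And>i. i < n \<Longrightarrow> i \<notin> {n - r..<Suc b} \<Longrightarrow> x $ i = 0" "A *\<^sub>v x = 0\<^sub>v n"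
      using * cols_indptI[OF A, of "{n - r..<Suc b}"] by blast
    have "x + x $ b \<cdot>\<^sub>v 0\<^sub>v n = x" using x by auto
    with x show ?thesis
      using trailing_col_relation[OF A indpt b(3) x(1-3), of "0\<^sub>v n"] that by auto
  qed
  have "\<exists>y. y \<in> carrier_vec n \<and> (\<forall>i<n. i \<notin> ?I \<longrightarrow> y $ i = 0) \<and> A *\<^sub>v unit_vec n j = A *\<^sub>v y"
    if j: "j < n" for j
  proof -
    consider "j > b" | "j = b" | "j < b" by linarith
    then show ?thesis
    proof cases
      case 1
      then show ?thesis using j b by (intro exI[of _ "unit_vec n j"]) auto
    next
      case 2
      then show ?thesis using yb b by (intro exI[of _ yb]) auto
    next
      case 3
      let ?T = "addrow_mat n (1::'a) j b"
      have T: "?T \<in> carrier_mat n n" by simp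
      have AT: "A * ?T \<in> carrier_mat n n" using A T by (rule mult_carrier_mat)
      obtain x where x: "x \<in> carrier_vec n" "x \<noteq> 0\<^sub>v n"
        "\<And>i. i < n \<Longrightarrow> i \<notin> {n - r..<Suc b} \<Longrightarrow> x $ i = 0" "(A * ?T) *\<^sub>v x = 0\<^sub>v n"
        using * 3 cols_indptI[OF AT, of "{n - r..<Suc b}"] by blast
      have "A *\<^sub>v (?T *\<^sub>v x) = 0\<^sub>v n" using x(4) A T x(1) by simp
      then have "A *\<^sub>v (x + x $ b \<cdot>\<^sub>v unit_vec n j) = 0\<^sub>v n"
        using addrow_mat_mult_vec[OF x(1) j b(3), of 1] 3 by simp
      then obtain y where y: "y \<in> carrier_vec n" "?supp y"
        "A *\<^sub>v (unit_vec n b + unit_vec n j) = A *\<^sub>v y"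
        using trailing_col_relation[OF A indpt b(3) x(1-3), of "unit_vec n j"] by auto
      have "A *\<^sub>v unit_vec n b + A *\<^sub>v unit_vec n j = A *\<^sub>v y"
        using y(3) A by (simp add: mult_add_distrib_mat_vec[of A n n])
      \<comment> \<open>Column \<open>b\<close> alone is already \<open>A *\<^sub>v yb\<close>, so
        subtracting it isolates column \<open>j\<close>.\<close>
      then have "A *\<^sub>v unit_vec n j = A *\<^sub>v y - A *\<^sub>v yb"
        using yb(3) A by (auto simp: vec_eq_iff algebra_simps)
      also have "\<dots> = A *\<^sub>v (y - yb)"
        using A y yb by (simp add: mult_minus_distrib_mat_vec[of A n n])
      finally show ?thesis using y yb b by (intro exI[of _ "y - yb"]) auto
    qed
  qed
  then obtain y where y: "\<And>j. j < n \<Longrightarrow> y j \<in> carrier_vec n"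
    "\<And>j i. j < n \<Longrightarrow> i < n \<Longrightarrow> i \<notin> ?I \<Longrightarrow> y j $ i = 0"
    "\<And>j. j < n \<Longrightarrow> A *\<^sub>v unit_vec n j = A *\<^sub>v y j" by metis
  define Y where "Y = mat_of_cols n (map y [0..<n])"
  have Y: "Y \<in> carrier_mat n n" by (intro carrier_matI) (simp_all add: Y_def)
  have AY: "A * Y = A"
  proof (rule mat_col_eqI)
    fix j assume "j < dim_col A"
    then have j: "j < n" using A by simp
    have "col (A * Y) j = A *\<^sub>v col Y j" by (rule col_mult2[OF A Y j])
    also have "col Y j = y j" using y j by (simp add: Y_def)
    also have "A *\<^sub>v y j = A *\<^sub>v unit_vec n j" using y j by simp
    also have "\<dots> = col A j" using A j by (intro eq_vecI) auto
    finally show "col (A * Y) j = col A j" .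
  qed (use A Y in auto)
  \<comment> \<open>The rows of \<open>Y\<close> outside \<open>?I\<close> are zero, so
    \<open>Y * E\<close> annihilates \<open>v\<close> as soon as fewer than \<open>r\<close>
    equations in \<open>r\<close> unknowns hold. Since \<open>A * Y = A\<close>, a nonzero solution
    contradicts the injectivity of \<open>A * E\<close>.\<close>
  have "card ?I < r" using b by (simp add: card_Diff_subset)
  then obtain v where v: "v \<in> carrier_vec r" "v \<noteq> 0\<^sub>v r" "\<And>i. i \<in> ?I \<Longrightarrow> row (Y * E) i \<bullet> v = 0"
    using homogeneous_system_nontrivial[of ?I r "row (Y * E)"] Y E by auto
  have z: "E *\<^sub>v v \<in> carrier_vec n" using E v by simp
  have "Y *\<^sub>v (E *\<^sub>v v) = 0\<^sub>v n"
  proof (rule eq_vecI)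
    fix i assume "i < dim_vec (0\<^sub>v n :: 'a vec)"
    then have i: "i < n" by simp
    show "(Y *\<^sub>v (E *\<^sub>v v)) $ i = 0\<^sub>v n $ i"
    proof (cases "i \<in> ?I")
      case True
      have "(Y *\<^sub>v (E *\<^sub>v v)) $ i = ((Y * E) *\<^sub>v v) $ i" using Y E v by simp
      also have "\<dots> = row (Y * E) i \<bullet> v" using Y i by simp
      finally show ?thesis using v(3)[OF True] i by simp
    next
      case False
      have "row Y i = 0\<^sub>v n"
        using y(2)[OF _ i False] i Y by (auto simp: Y_def mat_of_cols_def)
      then show ?thesis using Y i z by simp
    qed
  qed (use Y in auto)
  then have "(A * Y) *\<^sub>v (E *\<^sub>v v) = 0\<^sub>v n" using A Y z by auto
  then show False using inj[OF v(1)] v(2) by (simp add: AY)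
qed

text \<open>Induction on the number \<open>m\<close> of independent columns counted from
  \<open>n - r\<close>; each step keeps \<open>B\<close> or conjugates it by an elementary matrix.
  The zero rows and a matrix \<open>F\<close> with \<open>B * F\<close> injective are carried along,
  the latter because the next step requires it.\<close>

lemma similar_trailing_cols_indpt:
  fixes A :: "'a :: field mat"
  assumes A: "A \<in> carrier_mat n n" and E: "E \<in> carrier_mat n r" and r: "r \<le> n"
    and zero: "\<And>i j. r \<le> i \<Longrightarrow> i < n \<Longrightarrow> j < n \<Longrightarrow> A $$ (i, j) = 0"
    and inj: "\<And>v. v \<in> carrier_vec r \<Longrightarrow> A *\<^sub>v (E *\<^sub>v v) = 0\<^sub>v n \<Longrightarrow> v = 0\<^sub>v r"
  obtains B where "similar_mat A B" "B \<in> carrier_mat n n" "cols_indpt B {n - r..<n}"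
    "\<And>i j. r \<le> i \<Longrightarrow> i < n \<Longrightarrow> j < n \<Longrightarrow> B $$ (i, j) = 0"
proof -
  have "\<exists>B F. similar_mat A B \<and> B \<in> carrier_mat n n \<and> F \<in> carrier_mat n r \<and>
      (\<forall>i j. r \<le> i \<longrightarrow> i < n \<longrightarrow> j < n \<longrightarrow> B $$ (i, j) = 0) \<and>
      (\<forall>v \<in> carrier_vec r. B *\<^sub>v (F *\<^sub>v v) = 0\<^sub>v n \<longrightarrow> v = 0\<^sub>v r) \<and>
      cols_indpt B {n - r..<n - r + m}" if "m \<le> r" for m
    using that
  proof (induction m)
    case 0
    have "cols_indpt A {n - r..<n - r + 0}"
      by (rule cols_indptI[OF A]) (auto intro!: eq_vecI)
    then show ?case using A E zero inj similar_mat_refl[OF A] by blast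
  next
    case (Suc m)
    define b where "b = n - r + m"
    have b: "n - r \<le> b" "b < n" "n - r + Suc m = Suc b" using Suc.prems r by (auto simp: b_def)
    obtain B F where sim: "similar_mat A B" and B: "B \<in> carrier_mat n n" and F: "F \<in> carrier_mat n r"
      and zeroB: "\<And>i j. r \<le> i \<Longrightarrow> i < n \<Longrightarrow> j < n \<Longrightarrow> B $$ (i, j) = 0"
      and injB: "\<And>v. v \<in> carrier_vec r \<Longrightarrow> B *\<^sub>v (F *\<^sub>v v) = 0\<^sub>v n \<Longrightarrow> v = 0\<^sub>v r"
      and indpt: "cols_indpt B {n - r..<b}"
      using Suc by (auto simp: b_def)
    from cols_indpt_step[OF B F injB r b(1,2) indpt]
    consider "cols_indpt B {n - r..<Suc b}"
      | j where "j < b" "cols_indpt (B * addrow_mat n 1 j b) {n - r..<Suc b}" by blast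
    then show ?case
    proof cases
      case 1
      then show ?thesis unfolding b(3) using sim B F zeroB injB by blast
    next
      case (2 j)
      define T where "T = addrow_mat n (1::'a) j b"
      define T' where "T' = addrow_mat n (- 1 :: 'a) j b"
      have T: "T \<in> carrier_mat n n" and T': "T' \<in> carrier_mat n n" by (simp_all add: T_def T'_def)
      have TT': "T * T' = 1\<^sub>m n" and T'T: "T' * T = 1\<^sub>m n"
        using addrow_mat_inv[of j n b 1] addrow_mat_inv[of j n b "- 1"] 2(1) b
        by (auto simp: T_def T'_def)
      have BT: "B * T \<in> carrier_mat n n" using B T by simp
      \<comment> \<open>The factors \<open>T\<close> and \<open>T'\<close> cancel in
        \<open>?B * ?F\<close>, leaving \<open>T' * (B * F)\<close>, so injectivity
        survives.\<close>
      let ?B = "T' * (B * T)" and ?F = "T' * F"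
      have cB: "?B \<in> carrier_mat n n" and cF: "?F \<in> carrier_mat n r" using T' BT F by auto
      have "T * ?B * T' = (T * T') * B * (T * T')"
        using T T' B by (simp add: assoc_mult_mat[of _ n n _ n _ n])
      also have "\<dots> = B" using TT' B by simp
      finally have eq: "B = T * ?B * T'" ..
      have "similar_mat B ?B"
        using T T' B cB by (intro similar_matI[OF _ TT' T'T eq]) auto
      \<comment> \<open>Left multiplication by \<open>T'\<close> subtracts row \<open>b\<close> from
        row \<open>j\<close>. This is where \<open>j < b\<close> matters: if
        \<open>r \<le> j\<close>, then row \<open>b\<close> is zero too, and row \<open>j\<close>
        stays zero.\<close>
      moreover have "?B $$ (i, c) = 0" if "r \<le> i" "i < n" "c < n" for i c
      proof -
        have BT0: "(B * T) $$ (a, c) = 0" if "r \<le> a" "a < n" for a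
          using that \<open>c < n\<close> zeroB B T by (auto simp: scalar_prod_def)
        have "?B = addrow (- 1) j b (B * T)"
          unfolding T'_def using b by (intro addrow_mat[symmetric, OF BT]) auto
        then show ?thesis using that BT BT0[of i] BT0[of b] 2(1) b B T by auto
      qed
      moreover have "v = 0\<^sub>v r" if v: "v \<in> carrier_vec r" "?B *\<^sub>v (?F *\<^sub>v v) = 0\<^sub>v n" for v
      proof (rule injB[OF v(1)])
        have Fv: "F *\<^sub>v v \<in> carrier_vec n" using F v by simp
        have "?B *\<^sub>v (?F *\<^sub>v v) = T' *\<^sub>v (B *\<^sub>v ((T * T') *\<^sub>v (F *\<^sub>v v)))"
          using T T' B F v Fv by (simp add: assoc_mult_mat_vec[of _ n n _ n] assoc_mult_mat_vec[of _ n n _ r])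
        also have "\<dots> = T' *\<^sub>v (B *\<^sub>v (F *\<^sub>v v))" using TT' Fv by simp
        finally show "B *\<^sub>v (F *\<^sub>v v) = 0\<^sub>v n"
          using v(2) mult_mat_vec_eq_zero_cancel[OF T T' TT'] B Fv by simp
      qed
      \<comment> \<open>Left multiplication by the invertible \<open>T'\<close> does not change the
        kernel, so independence passes from \<open>B * T\<close> to \<open>?B\<close>.\<close>
      moreover have "cols_indpt ?B {n - r..<Suc b}"
      proof (rule cols_indptI[OF cB])
        fix x assume x: "x \<in> carrier_vec n" "\<And>i. i < n \<Longrightarrow> i \<notin> {n - r..<Suc b} \<Longrightarrow> x $ i = 0"
          "?B *\<^sub>v x = 0\<^sub>v n"
        have "T' *\<^sub>v ((B * T) *\<^sub>v x) = 0\<^sub>v n" using x(1,3) T' BT by simp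
        then have "(B * T) *\<^sub>v x = 0\<^sub>v n"
          using mult_mat_vec_eq_zero_cancel[OF T T' TT'] BT x(1) by simp
        then show "x = 0\<^sub>v n" using cols_indptD[OF 2(2)[folded T_def] BT x(1)] x(2) by blast
      qed
      ultimately show ?thesis unfolding b(3) using similar_mat_trans[OF sim] cB cF by blast
    qed
  qed
  from this[of r] show ?thesis using that r by auto
qed

section \<open>Shift matrices and the invertibility of \<open>B - shift_mat n r\<close>\<close>

definition shift_mat :: "nat \<Rightarrow> nat \<Rightarrow> 'a :: semiring_1 mat" where
  "shift_mat n r = mat n n (\<lambda>(i, j). if i = j + r then 1 else 0)"

lemma shift_mat_carrier [simp]: "shift_mat n r \<in> carrier_mat n n"
  by (simp add: shift_mat_def)

lemma shift_mat_dim [simp]: "dim_row (shift_mat n r) = n" "dim_col (shift_mat n r) = n"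
  by (simp_all add: shift_mat_def)

lemma shift_mat_pow: "shift_mat n r ^\<^sub>m m = shift_mat n (m * r)"
proof (induction m)
  case 0
  show ?case by (rule eq_matI) (auto simp: shift_mat_def)
next
  case (Suc m)
  show ?case
  proof (rule eq_matI)
    fix i j assume "i < dim_row (shift_mat n (Suc m * r) :: 'a mat)"
      "j < dim_col (shift_mat n (Suc m * r) :: 'a mat)"
    then have ij: "i < n" "j < n" by (auto simp: shift_mat_def)
    have "(shift_mat n r ^\<^sub>m Suc m) $$ (i, j) =
        (\<Sum>c\<in>{0..<n}. shift_mat n (m * r) $$ (i, c) * shift_mat n r $$ (c, j) :: 'a)"
      using ij by (simp add: Suc scalar_prod_def)
    also have "\<dots> =
        (\<Sum>c\<in>{0..<n}. if c = j + r then if i = c + m * r then (1 :: 'a) else 0 else 0)"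
      using ij by (intro sum.cong) (auto simp: shift_mat_def)
    \<comment> \<open>If \<open>j + r\<close> is at least \<open>n\<close>, no summand survives; the
      right-hand side is then zero as well, because \<open>i < n\<close>.\<close>
    also have "\<dots> = (if i = j + Suc m * r then 1 else 0)"
      using ij by (auto simp: algebra_simps)
    also have "\<dots> = shift_mat n (Suc m * r) $$ (i, j)"
      using ij by (simp add: shift_mat_def)
    finally show "(shift_mat n r ^\<^sub>m Suc m) $$ (i, j) = (shift_mat n (Suc m * r) :: 'a mat) $$ (i, j)" .
  qed (auto simp: shift_mat_def Suc)
qed

lemma shift_mat_eq_zero: "n \<le> r \<Longrightarrow> shift_mat n r = 0\<^sub>m n n"
  by (rule eq_matI) (auto simp: shift_mat_def)

lemma shift_mat_mult_vec:
  fixes x :: "'a :: comm_ring_1 vec"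
  assumes "x \<in> carrier_vec n" "i < n"
  shows "(shift_mat n r *\<^sub>v x) $ i = (if r \<le> i then x $ (i - r) else 0)"
proof -
  have "(shift_mat n r *\<^sub>v x) $ i = (\<Sum>c\<in>{0..<n}. if i = c + r then x $ c else 0)"
    using assms by (auto simp: shift_mat_def scalar_prod_def intro!: sum.cong)
  also have "\<dots> = (\<Sum>c\<in>{0..<n}. if c = i - r then if r \<le> i then x $ c else 0 else 0)"
    by (intro sum.cong) auto
  finally show ?thesis using assms by auto
qed

text \<open>For a kernel vector \<open>x\<close>, \<open>B\<close> and the shift agree on
  \<open>x\<close>. Entry \<open>i + r\<close> of the shifted vector is \<open>x $ i\<close>, while
  row \<open>i + r\<close> of \<open>B\<close> is zero, so \<open>x\<close> is supported on the last
  \<open>r\<close> indices. The shift kills such a vector, hence so does \<open>B\<close>, and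
  independence of its last columns gives \<open>x = 0\<close>.\<close>

lemma det_minus_shift_mat_nonzero:
  fixes B :: "'a :: field mat"
  assumes B: "B \<in> carrier_mat n n" and indpt: "cols_indpt B {n - r..<n}"
    and zero: "\<And>i j. r \<le> i \<Longrightarrow> i < n \<Longrightarrow> j < n \<Longrightarrow> B $$ (i, j) = 0"
  shows "det (B - shift_mat n r) \<noteq> 0"
proof
  let ?S = "shift_mat n r :: 'a mat"
  have S: "?S \<in> carrier_mat n n" by simp
  have BS: "B - ?S \<in> carrier_mat n n" using S by (rule minus_carrier_mat)
  assume "det (B - ?S) = 0"
  then obtain x where x: "x \<in> carrier_vec n" "x \<noteq> 0\<^sub>v n" "(B - ?S) *\<^sub>v x = 0\<^sub>v n"
    using det_0_iff_vec_prod_zero_field[OF BS] by blast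
  have "B *\<^sub>v x - ?S *\<^sub>v x = 0\<^sub>v n"
    using x B S by (simp add: minus_mult_distrib_mat_vec[of _ n n])
  then have eq: "B *\<^sub>v x = ?S *\<^sub>v x" using B x S by (auto simp: vec_eq_iff)
  have x0: "x $ i = 0" if "i < n - r" for i
  proof -
    have "x $ i = (B *\<^sub>v x) $ (i + r)"
      using that x shift_mat_mult_vec[of x n "i + r" r] by (simp add: eq)
    also have "\<dots> = 0" using that B x zero[of "i + r"] by (auto simp: scalar_prod_def)
    finally show ?thesis .
  qed
  have "?S *\<^sub>v x = 0\<^sub>v n"
  proof (rule eq_vecI)
    fix i assume "i < dim_vec (0\<^sub>v n :: 'a vec)"
    then show "(?S *\<^sub>v x) $ i = 0\<^sub>v n $ i"
      using shift_mat_mult_vec[OF x(1), of i r] x0[of "i - r"] by auto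
  qed simp
  then have "x = 0\<^sub>v n" using cols_indptD[OF indpt B x(1)] x0 eq by auto
  with x show False by simp
qed

section \<open>Invertibility by determinants, and the two directions of the equivalence\<close>

lemma invertible_mat_iff_det:
  fixes U :: "'a :: field mat"
  assumes U: "U \<in> carrier_mat n n"
  shows "invertible_mat U \<longleftrightarrow> det U \<noteq> 0"
proof
  assume "invertible_mat U"
  then obtain W where W: "U * W = 1\<^sub>m n" "W * U = 1\<^sub>m (dim_row W)"
    using U unfolding invertible_mat_def inverts_mat_def by auto
  \<comment> \<open>\<open>invertible_mat\<close> does not fix the size of the inverse; it is read
    off from the dimensions of the two products.\<close>
  have "dim_col W = n" "dim_row W = n"
    using arg_cong[OF W(1), of dim_col] arg_cong[OF W(2), of dim_col] U by auto
  then have "W \<in> carrier_mat n n" by auto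
  then have "det U * det W = 1" using det_mult[OF U, of W] W(1) by simp
  then show "det U \<noteq> 0" by auto
next
  assume "det U \<noteq> 0"
  then obtain W where "W \<in> carrier_mat n n" "U * W = 1\<^sub>m n" "W * U = 1\<^sub>m n"
    using det_nonzero_inverse[OF U] by blast
  then show "invertible_mat U" using U unfolding invertible_mat_def inverts_mat_def by auto
qed

lemma rank_bound_if_unit_plus_nilpotent:
  fixes U N :: "'a :: field mat"
  assumes U: "U \<in> carrier_mat n n" and N: "N \<in> carrier_mat n n"
    and det: "det U \<noteq> 0" and Nk: "N ^\<^sub>m k = 0\<^sub>m n n"
  shows "n \<le> k * vec_space.rank n (U + N)"
proof (rule ccontr)
  interpret vec_space "TYPE('a)" n .
  let ?A = "U + N"
  define r where "r = rank ?A"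
  assume "\<not> ?thesis"
  then have less: "k * r < n" by (simp add: r_def)
  have A: "?A \<in> carrier_mat n n" using U N by simp
  obtain P Q where P: "P \<in> carrier_mat n n" and Q: "Q \<in> carrier_mat n n" and PQ: "P * Q = 1\<^sub>m n"
    and zero: "\<And>i j. r \<le> i \<Longrightarrow> i < n \<Longrightarrow> j < n \<Longrightarrow> (Q * ?A) $$ (i, j) = 0"
    using rank_row_reduction[OF A] unfolding r_def by metis
  have pow: "N ^\<^sub>m i \<in> carrier_mat n n" for i using N by simp
  have QA: "Q * ?A \<in> carrier_mat n n" using Q A by simp
  \<comment> \<open>Only the first \<open>r\<close> rows of \<open>Q * ?A\<close> can be nonzero, so
    these \<open>k * r\<close> functionals express that \<open>?A\<close> kills
    \<open>N ^\<^sub>m i *\<^sub>v x\<close> for all \<open>i < k\<close>.\<close>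
  define g where "g = (\<lambda>(i, j). row (Q * ?A * N ^\<^sub>m i) j)"
  have "card ({..<k} \<times> {..<r}) < n" using less by simp
  moreover have "g p \<in> carrier_vec n" if "p \<in> {..<k} \<times> {..<r}" for p
    using that QA N by (auto simp: g_def intro!: carrier_vecI)
  ultimately obtain x where x: "x \<in> carrier_vec n" "x \<noteq> 0\<^sub>v n"
    and gx: "\<And>p. p \<in> {..<k} \<times> {..<r} \<Longrightarrow> g p \<bullet> x = 0"
    using homogeneous_system_nontrivial[of "{..<k} \<times> {..<r}" n g] by auto
  define y where "y = (\<lambda>i. N ^\<^sub>m i *\<^sub>v x)"
  have y: "y i \<in> carrier_vec n" for i using N by (intro carrier_vecI) (simp add: y_def)
  \<comment> \<open>Matrix powers multiply on the right, whereas the recursion for \<open>y\<close>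
    applies \<open>N\<close> on the left.\<close>
  have pow_comm: "N * N ^\<^sub>m i = N ^\<^sub>m i * N" for i
  proof (induction i)
    case (Suc i)
    have "N * N ^\<^sub>m Suc i = (N * N ^\<^sub>m i) * N"
      using N pow by (simp add: assoc_mult_mat[of _ n n _ n _ n])
    then show ?case by (simp add: Suc)
  qed (use N in simp)
  have y_Suc: "y (Suc i) = N *\<^sub>v y i" for i
  proof -
    have "N *\<^sub>v y i = (N * N ^\<^sub>m i) *\<^sub>v x" by (simp add: y_def assoc_mult_mat_vec[OF N pow x(1)])
    then show ?thesis by (simp add: pow_comm y_def)
  qed
  have Ay: "?A *\<^sub>v y i = 0\<^sub>v n" if i: "i < k" for i
  proof -
    have "(Q * ?A) *\<^sub>v y i = 0\<^sub>v n"
    proof (rule eq_vecI)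
      fix j assume "j < dim_vec (0\<^sub>v n :: 'a vec)"
      then have j: "j < n" by simp
      show "((Q * ?A) *\<^sub>v y i) $ j = 0\<^sub>v n $ j"
      proof (cases "j < r")
        case True
        have "((Q * ?A) *\<^sub>v y i) $ j = ((Q * ?A * N ^\<^sub>m i) *\<^sub>v x) $ j"
          using QA pow x by (simp only: y_def assoc_mult_mat_vec[OF QA pow x(1)])
        also have "\<dots> = g (i, j) \<bullet> x" using j Q by (simp add: g_def)
        finally show ?thesis using gx[of "(i, j)"] i True j by simp
      next
        case False
        then have "row (Q * ?A) j = 0\<^sub>v n"
          using zero[of j] j QA by (intro eq_vecI) (auto simp del: index_mult_mat)
        moreover have "((Q * ?A) *\<^sub>v y i) $ j = row (Q * ?A) j \<bullet> y i"
          using j Q by (intro index_mult_mat_vec) simp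
        ultimately show ?thesis using j y[of i] by simp
      qed
    qed (use QA in auto)
    then have "Q *\<^sub>v (?A *\<^sub>v y i) = 0\<^sub>v n" using Q A y by simp
    then show ?thesis using mult_mat_vec_eq_zero_cancel[OF P Q PQ] A y by simp
  qed
  have step: "y i = 0\<^sub>v n" if "i < k" "y (Suc i) = 0\<^sub>v n" for i
  proof -
    have "U *\<^sub>v y i + N *\<^sub>v y i = 0\<^sub>v n"
      using Ay[OF that(1)] U N y by (simp add: add_mult_distrib_mat_vec[of _ n n])
    then have "U *\<^sub>v y i = 0\<^sub>v n" using that(2) U y by (simp add: y_Suc[symmetric])
    then show ?thesis using det det_0_iff_vec_prod_zero_field[OF U] y by blast
  qed
  \<comment> \<open>Descent from \<open>y k\<close> to \<open>y 0 = x\<close>. Once \<open>i\<close>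
    reaches \<open>k\<close>, truncated subtraction keeps the index at 0 and the induction step is
    trivial.\<close>
  have "y (k - i) = 0\<^sub>v n" for i
  proof (induction i)
    case 0
    show ?case using Nk x by (auto simp: y_def)
  next
    case (Suc i)
    then show ?case using step[of "k - Suc i"]
      by (cases "i < k") (simp_all add: Suc_diff_Suc)
  qed
  from this[of k] show False using x N by (simp add: y_def)
qed

text \<open>A splitting into an invertible and a nilpotent summand is carried along by similarity.
  It thus suffices to split a matrix \<open>B\<close> similar to \<open>A\<close>, with zero rows
  from \<open>r\<close> on and independent last \<open>r\<close> columns, as
  \<open>(B - ?S) + ?S\<close>.\<close>

lemma unit_plus_nilpotent_if_rank_bound:
  fixes A :: "'a :: field mat"
  assumes A: "A \<in> carrier_mat n n" and bound: "n \<le> k * vec_space.rank n A"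
  obtains U N where "U \<in> carrier_mat n n" "N \<in> carrier_mat n n" "det U \<noteq> 0"
    "N ^\<^sub>m k = 0\<^sub>m n n" "A = U + N"
proof -
  interpret vec_space "TYPE('a)" n .
  define r where "r = rank A"
  have r: "r \<le> n" using rank_le_nc[OF A] by (simp add: r_def)
  obtain P Q E where P: "P \<in> carrier_mat n n" and Q: "Q \<in> carrier_mat n n"
    and PQ: "P * Q = 1\<^sub>m n" and QP: "Q * P = 1\<^sub>m n"
    and zero: "\<And>i j. r \<le> i \<Longrightarrow> i < n \<Longrightarrow> j < n \<Longrightarrow> (Q * A) $$ (i, j) = 0"
    and E: "E \<in> carrier_mat n r"
    and inj: "\<And>v. v \<in> carrier_vec r \<Longrightarrow> A *\<^sub>v (E *\<^sub>v v) = 0\<^sub>v n \<Longrightarrow> v = 0\<^sub>v r"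
    using rank_row_reduction[OF A] unfolding r_def by metis
  \<comment> \<open>Multiplying by \<open>P\<close> on the right keeps the zero rows of
    \<open>Q * A\<close> and turns the row reduction into a similarity.\<close>
  define A1 where "A1 = Q * A * P"
  have QA: "Q * A \<in> carrier_mat n n" using Q A by simp
  have A1: "A1 \<in> carrier_mat n n" using QA P by (simp add: A1_def)
  have QE: "Q * E \<in> carrier_mat n r" using Q E by simp
  have "P * A1 * Q = (P * Q) * A * (P * Q)"
    using P Q A by (simp add: A1_def assoc_mult_mat[of _ n n _ n _ n])
  also have "\<dots> = A" using PQ A by simp
  finally have eq: "A = P * A1 * Q" ..
  have sim1: "similar_mat A A1"
    using P Q A A1 by (intro similar_matI[OF _ PQ QP eq]) auto
  have zero1: "A1 $$ (i, j) = 0" if "r \<le> i" "i < n" "j < n" for i j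
  proof -
    have "row (Q * A) i = 0\<^sub>v n"
      using zero[of i] that QA by (intro eq_vecI) (auto simp del: index_mult_mat)
    moreover have "A1 $$ (i, j) = row (Q * A) i \<bullet> col P j"
      using that QA P unfolding A1_def by (subst index_mult_mat) auto
    ultimately show ?thesis using P that by simp
  qed
  have inj1: "v = 0\<^sub>v r" if v: "v \<in> carrier_vec r" "A1 *\<^sub>v ((Q * E) *\<^sub>v v) = 0\<^sub>v n" for v
  proof (rule inj[OF v(1)])
    have Ev: "E *\<^sub>v v \<in> carrier_vec n" using E v by simp
    have "A1 *\<^sub>v ((Q * E) *\<^sub>v v) = Q *\<^sub>v (A *\<^sub>v ((P * Q) *\<^sub>v (E *\<^sub>v v)))"
      using P Q A E v Ev
      by (simp add: A1_def assoc_mult_mat_vec[of _ n n _ n] assoc_mult_mat_vec[of _ n n _ r])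
    also have "\<dots> = Q *\<^sub>v (A *\<^sub>v (E *\<^sub>v v))" using PQ Ev by simp
    finally show "A *\<^sub>v (E *\<^sub>v v) = 0\<^sub>v n"
      using v(2) mult_mat_vec_eq_zero_cancel[OF P Q PQ] A Ev by simp
  qed
  obtain B where sim2: "similar_mat A1 B" and B: "B \<in> carrier_mat n n"
    and indpt: "cols_indpt B {n - r..<n}"
    and zeroB: "\<And>i j. r \<le> i \<Longrightarrow> i < n \<Longrightarrow> j < n \<Longrightarrow> B $$ (i, j) = 0"
    using similar_trailing_cols_indpt[OF A1 QE r zero1 inj1] by blast
  obtain R L where wit: "similar_mat_wit A B R L"
    using similar_mat_trans[OF sim1 sim2] unfolding similar_mat_def by blast
  note RL = similar_mat_witD2[OF A wit]
  let ?S = "shift_mat n r :: 'a mat"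
  define U where "U = R * (B - ?S) * L"
  define N where "N = R * ?S * L"
  have S: "?S \<in> carrier_mat n n" by simp
  have BS: "B - ?S \<in> carrier_mat n n" using S by (rule minus_carrier_mat)
  have U: "U \<in> carrier_mat n n" using RL BS by (auto simp: U_def)
  have N: "N \<in> carrier_mat n n" using RL S by (auto simp: N_def)
  have "similar_mat U (B - ?S)"
    using RL BS U by (intro similar_matI[of _ _ R L n]) (auto simp: U_def)
  then have "det U \<noteq> 0"
    using det_similar det_minus_shift_mat_nonzero[OF B indpt zeroB] by metis
  moreover have "similar_mat_wit N ?S R L"
    using RL S N by (intro similar_mat_witI[of _ _ n]) (auto simp: N_def)
  then have "N ^\<^sub>m k = R * ?S ^\<^sub>m k * L" by (rule similar_mat_wit_pow_id)
  \<comment> \<open>The power of the shift moves indices by \<open>k * r\<close>, which is at least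
    \<open>n\<close> by the rank bound.\<close>
  then have "N ^\<^sub>m k = 0\<^sub>m n n"
    using bound RL by (simp add: shift_mat_pow shift_mat_eq_zero r_def)
  moreover have "A = U + N"
  proof -
    have "U + N = R * ((B - ?S) + ?S) * L"
      using RL BS S by (simp add: U_def N_def mult_add_distrib_mat[of _ n n] add_mult_distrib_mat[of _ n n])
    also have "(B - ?S) + ?S = B" using B S by auto
    finally show ?thesis using RL by simp
  qed
  ultimately show ?thesis using that U N by blast
qed

theorem theorem2p7:
  fixes A :: "'a :: field mat" and n k :: nat
  assumes "n \<ge> 2" and "k \<ge> 1"
    and "A \<in> carrier_mat n n" and "A \<noteq> 0\<^sub>m n n"
  shows "(\<exists>U \<in> carrier_mat n n. \<exists>N \<in> carrier_mat n n.
            invertible_mat U \<and> nilpotent_mat N \<and> N ^\<^sub>m k = 0\<^sub>m n n \<and> A = U + N)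
         \<longleftrightarrow> (of_nat (vec_space.rank n A) :: rat) \<ge> of_nat n / of_nat k"
  (is "?decomposes \<longleftrightarrow> ?bound")
proof -
  let ?r = "vec_space.rank n A"
  have "?bound \<longleftrightarrow> (of_nat n :: rat) \<le> of_nat (k * ?r)"
    using assms(2) by (simp add: divide_le_eq mult.commute)
  then have "?bound \<longleftrightarrow> n \<le> k * ?r" by (simp only: of_nat_le_iff)
  moreover have "?decomposes \<longleftrightarrow> n \<le> k * ?r"
  proof
    assume ?decomposes
    then obtain U N where UN: "U \<in> carrier_mat n n" "N \<in> carrier_mat n n" "invertible_mat U"
      "N ^\<^sub>m k = 0\<^sub>m n n" "A = U + N" by blast
    then have "det U \<noteq> 0" using invertible_mat_iff_det[OF UN(1)] by simp
    then show "n \<le> k * ?r"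
      unfolding UN(5) by (rule rank_bound_if_unit_plus_nilpotent[OF UN(1,2) _ UN(4)])
  next
    assume "n \<le> k * ?r"
    then obtain U N where UN: "U \<in> carrier_mat n n" "N \<in> carrier_mat n n" "det U \<noteq> 0"
      "N ^\<^sub>m k = 0\<^sub>m n n" "A = U + N"
      using unit_plus_nilpotent_if_rank_bound[OF assms(3)] by blast
    \<comment> \<open>The exponent \<open>k\<close> itself is the witness, admissible since
      \<open>k\<close> is at least 1.\<close>
    have "nilpotent_mat N"
      unfolding nilpotent_mat_def using UN(2,4) assms(2) by auto
    moreover have "invertible_mat U" using invertible_mat_iff_det[OF UN(1)] UN(3) by simp
    ultimately show ?decomposes using UN by blast
  qed
  ultimately show ?thesis by simp
qed

end
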